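(* Consider the open-road closed-loop system described in the context, with initial condition $(s(0),v(0))\in\Omega_S$, and let $$\Gamma=\max_{i=1,\dots,n}\left(\frac{|v_i(0)-f_i(s(0))|}{\sqrt{(v_{\max}-v_i(0))v_i(0)}}\right).$$ Suppose that $$\min_{i=2,\dots,n}(s_i(0))\ge\lambda+\frac{v_{\max}}{\mu}\Gamma.$$ Then the unique solution of the closed-loop system satisfies for all $t\ge 0$ $$\max_{i=1,\dots,n}\big(|v_i(t)-v^*|\big)\le\frac{v_{\max}}{2}\Gamma\exp(-\mu t)\qquad\text{and}\qquad\min_{i=2,\dots,n}(s_i(t))\ge\lambda.$$
   Context: Constants: integer $n\ge 2$; $\lambda>L>0$; $v_{\max}>0$; $v^*\in(0,v_{\max})$; $\mu>0$; $\mathbb{R}_+=[0,+\infty)$. Functions: $V\in C^3((L,+\infty);\mathbb{R}_+)$ satisfies $\lim_{x\to L^+}V(x)=+\infty$, $V(x)=0$ for $x\ge\lambda$, and $V'(x)<0$, $V''(x)>0$ for $x\in(L,\lambda)$. $b:\mathbb{R}\to(v^*-v_{\max},v^* )$ is $C^2$ and increasing, with $b(0)=0$, $xb(x)>0$ for $x\ne 0$, and $b'(0)>0$. State: $s=(s_2,\dots,s_n)\in\mathbb{R}^{n-1}$, $v=(v_1,\dots,v_n)\in\mathbb{R}^n$, with the convention $s_1=s_{n+1}=+\infty$ and $V'(s_1)=V''(s_1)=V'(s_{n+1})=V''(s_{n+1})=0$ (so terms involving $v_0$ or $v_{n+1}$ below are multiplied by zero and vanish). State space (open set): $$\Omega_S=\Big\{(s,v)\in\mathbb{R}^{2n-1}:\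 \min_{i=2,\dots,n}s_i>L,\ \max_{i=1,\dots,n}v_i<v_{\max},\ \min_{i=1,\dots,n}v_i>0\Big\}.$$ Define, for $i=1,\dots,n$, $$f_i(s)=v^*-b\big(V'(s_{i+1})-V'(s_i)\big),$$ $$Z_i(s,v)=-v_{\max}^2\,b'\big(V'(s_{i+1})-V'(s_i)\big)\big(V''(s_{i+1})(v_i-v_{i+1})-V''(s_i)(v_{i-1}-v_i)\big),$$ and for $w,y\in(0,v_{\max})$ $$\beta(w,y)=\frac{v_{\max}^3(w+y)-2v_{\max}^2yw}{2(v_{\max}-w)^2w^2}\ (>0).$$ The open-road closed-loop system on $\Omega_S$ is $$\dot{s}_i=v_{i-1}-v_i,\ i=2,\dots,n,\qquad \dot{v}_i=F_i,\ i=1,\dots,n,$$ $$F_i=\frac{1}{\beta(v_i,f_i(s))}\left(\frac{Z_i(s,v)-\mu v_{\max}^2(v_i-f_i(s))}{v_i(v_{\max}-v_i)}+V'(s_i)-V'(s_{i+1})\right).$$ *)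

theory Defs
  imports "HOL-Analysis.Analysis"
begin

text \<open>\<open>f\<close> is \<open>k\<close> times continuously differentiable on the set \<open>S\<close>; meant for open \<open>S\<close>, where
  the iterated derivatives depend only on the values of \<open>f\<close> on \<open>S\<close>.\<close>

definition C_on :: "nat \<Rightarrow> (real \<Rightarrow> real) \<Rightarrow> real set \<Rightarrow> bool" where
  "C_on k f S \<longleftrightarrow>
     (\<forall>j<k. \<forall>x\<in>S. (deriv ^^ j) f differentiable (at x)) \<and>
     (\<forall>j\<le>k. continuous_on S ((deriv ^^ j) f))"

text \<open>States are pairs \<open>(s, v)\<close> of functions on \<open>nat\<close> of which only the components \<open>s i\<close> with
  \<open>2 \<le> i \<le> n\<close> and \<open>v i\<close> with \<open>1 \<le> i \<le> n\<close> are meaningful.\<close>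

definition state_space :: "nat \<Rightarrow> real \<Rightarrow> real \<Rightarrow> ((nat \<Rightarrow> real) \<times> (nat \<Rightarrow> real)) set" where
  "state_space n L vmax =
     {(s, v). (MIN i\<in>{2..n}. s i) > L \<and> (MAX i\<in>{1..n}. v i) < vmax \<and> (MIN i\<in>{1..n}. v i) > 0}"

text \<open>The values \<open>V'(s\<^sub>i)\<close> and \<open>V''(s\<^sub>i)\<close> with the open-road convention \<open>s\<^sub>1 = s\<^sub>n\<^sub>+\<^sub>1 = +\<infinity>\<close>,
  under which they vanish for \<open>i = 1\<close> and \<open>i = n + 1\<close>. Hence \<open>v 0\<close> and \<open>v (n + 1)\<close> below are
  always multiplied by zero.\<close>

definition dV :: "nat \<Rightarrow> (real \<Rightarrow> real) \<Rightarrow> (nat \<Rightarrow> real) \<Rightarrow> nat \<Rightarrow> real" where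
  "dV n V s i = (if i \<in> {2..n} then deriv V (s i) else 0)"

definition ddV :: "nat \<Rightarrow> (real \<Rightarrow> real) \<Rightarrow> (nat \<Rightarrow> real) \<Rightarrow> nat \<Rightarrow> real" where
  "ddV n V s i = (if i \<in> {2..n} then deriv (deriv V) (s i) else 0)"

definition f_ref ::
  "nat \<Rightarrow> real \<Rightarrow> (real \<Rightarrow> real) \<Rightarrow> (real \<Rightarrow> real) \<Rightarrow> nat \<Rightarrow> (nat \<Rightarrow> real) \<Rightarrow> real" where
  "f_ref n vstar V b i s = vstar - b (dV n V s (i + 1) - dV n V s i)"

definition Z_term ::
  "nat \<Rightarrow> real \<Rightarrow> (real \<Rightarrow> real) \<Rightarrow> (real \<Rightarrow> real) \<Rightarrow> nat \<Rightarrow> (nat \<Rightarrow> real) \<Rightarrow> (nat \<Rightarrow> real) \<Rightarrow> real" where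
  "Z_term n vmax V b i s v =
     - vmax\<^sup>2 * deriv b (dV n V s (i + 1) - dV n V s i) *
       (ddV n V s (i + 1) * (v i - v (i + 1)) - ddV n V s i * (v (i - 1) - v i))"

definition beta :: "real \<Rightarrow> real \<Rightarrow> real \<Rightarrow> real" where
  "beta vmax w y =
     (vmax ^ 3 * (w + y) - 2 * vmax\<^sup>2 * y * w) / (2 * (vmax - w)\<^sup>2 * w\<^sup>2)"

definition F_ctrl ::
  "nat \<Rightarrow> real \<Rightarrow> real \<Rightarrow> real \<Rightarrow> (real \<Rightarrow> real) \<Rightarrow> (real \<Rightarrow> real) \<Rightarrow>
   nat \<Rightarrow> (nat \<Rightarrow> real) \<Rightarrow> (nat \<Rightarrow> real) \<Rightarrow> real" where
  "F_ctrl n vmax vstar \<mu> V b i s v =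
     1 / beta vmax (v i) (f_ref n vstar V b i s) *
     ((Z_term n vmax V b i s v - \<mu> * vmax\<^sup>2 * (v i - f_ref n vstar V b i s)) / (v i * (vmax - v i))
      + dV n V s i - dV n V s (i + 1))"

text \<open>Derivatives are taken within the time interval \<open>J\<close>, i.e. one-sided at its left end point.\<close>

definition is_solution ::
  "nat \<Rightarrow> real \<Rightarrow> real \<Rightarrow> real \<Rightarrow> real \<Rightarrow> (real \<Rightarrow> real) \<Rightarrow> (real \<Rightarrow> real) \<Rightarrow>
   real set \<Rightarrow> (real \<Rightarrow> nat \<Rightarrow> real) \<Rightarrow> (real \<Rightarrow> nat \<Rightarrow> real) \<Rightarrow> bool" where
  "is_solution n L vmax vstar \<mu> V b J s v \<longleftrightarrow>
     (\<forall>t\<in>J.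
        (s t, v t) \<in> state_space n L vmax \<and>
        (\<forall>i\<in>{2..n}. ((\<lambda>t. s t i) has_real_derivative (v t (i - 1) - v t i)) (at t within J)) \<and>
        (\<forall>i\<in>{1..n}. ((\<lambda>t. v t i) has_real_derivative
            F_ctrl n vmax vstar \<mu> V b i (s t) (v t)) (at t within J)))"

definition has_initial_state ::
  "nat \<Rightarrow> (nat \<Rightarrow> real) \<Rightarrow> (nat \<Rightarrow> real) \<Rightarrow>
   (real \<Rightarrow> nat \<Rightarrow> real) \<Rightarrow> (real \<Rightarrow> nat \<Rightarrow> real) \<Rightarrow> bool" where
  "has_initial_state n s0 v0 s v \<longleftrightarrow>
     (\<forall>i\<in>{2..n}. s 0 i = s0 i) \<and> (\<forall>i\<in>{1..n}. v 0 i = v0 i)"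

end

theory Submission
  imports Defs
begin

text \<open>
  The whole proof rests on one change of variables. Measure the deviation of the speed \<open>v\<^sub>i\<close> from
  its reference \<open>f\<^sub>i\<close> by \<open>\<psi>\<^sub>i = (v\<^sub>i - f\<^sub>i) / sqrt ((vmax - v\<^sub>i) v\<^sub>i)\<close>, the quantity
  whose largest initial absolute value is \<open>\<Gamma>\<close>. Up to the factor \<open>sqrt ((vmax - v\<^sub>i) v\<^sub>i) / vmax\<^sup>2\<close>,
  the gain \<open>\<beta>\<close> is the derivative of \<open>\<psi>\<^sub>i\<close> with respect to \<open>v\<^sub>i\<close>, and \<open>Z\<^sub>i / vmax\<^sup>2\<close> is the
  time derivative of \<open>f\<^sub>i\<close>. So the feedback law is exactly what makes every solution satisfy
  \<open>\<psi>\<^sub>i' = - \<mu> \<psi>\<^sub>i + sqrt ((vmax - v\<^sub>i) v\<^sub>i) / vmax\<^sup>2 (V'(s\<^sub>i) - V'(s\<^sub>i\<^sub>+\<^sub>1))\<close>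
  (\<open>solution_rel_err_has_derivative\<close>).

  While all spacings are at least \<open>lam\<close>, the vehicles do not interact: \<open>f\<^sub>i = vstar\<close> and
  \<open>\<psi>\<^sub>i\<close> decays like \<open>exp (- \<mu> t)\<close>. Since \<open>\<bar>v - vstar\<bar> \<le> vmax / 2 \<bar>\<psi>\<bar>\<close>, a spacing shrinks at a rate of at
  most \<open>vmax \<Gamma> exp (- \<mu> t)\<close>, hence altogether by at most \<open>vmax \<Gamma> / \<mu>\<close>, which is the reserve
  granted initially. Moreover \<open>v \<mapsto> \<psi>\<close> has an explicit inverse on \<open>(0, vmax)\<close>, so the speeds are
  known in closed form, the spacings are their integrals, and this defines a global solution.

  Uniqueness is clear among solutions that keep all spacings at least \<open>lam\<close>, so it remains to see
  that every solution does (\<open>stays_apart\<close>). If \<open>\<Gamma> > 0\<close>, the estimate above is strict at all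
  times, so there is no first time at which a spacing equals \<open>lam\<close>. If \<open>\<Gamma> = 0\<close>, a spacing
  may be equal to \<open>lam\<close> from the beginning and this argument breaks down. In this case the energy
  \<open>vmax\<^sup>2 / 2 (\<Sum>i. \<psi>\<^sub>i\<^sup>2) + (\<Sum>i. V (s\<^sub>i))\<close> vanishes initially; it never increases
  (\<open>energy_le_initial\<close>), so it stays zero, which forces \<open>V (s\<^sub>i) = 0\<close> and thus \<open>s\<^sub>i \<ge> lam\<close>.
\<close>

section \<open>Derivatives on half-open time intervals\<close>

lemma nonincreasing_from_start:
  fixes f f' :: "real \<Rightarrow> real"
  assumes deriv: "\<And>\<tau>. \<tau> \<in> {0..<T} \<Longrightarrow> (f has_real_derivative f' \<tau>) (at \<tau> within {0..<T})"
    and t: "t \<in> {0..<T}"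
    and le: "\<And>\<tau>. 0 < \<tau> \<Longrightarrow> \<tau> < t \<Longrightarrow> f' \<tau> \<le> 0"
  shows "f t \<le> f 0"
proof (rule DERIV_nonpos_imp_decreasing_open[where f = f])
  show "0 \<le> t" using t by simp
  show "\<exists>y. (f has_real_derivative y) (at \<tau>) \<and> y \<le> 0" if "0 < \<tau>" "\<tau> < t" for \<tau>
  proof -
    have "(f has_real_derivative f' \<tau>) (at \<tau> within {0<..<T})"
      using deriv[of \<tau>] that t by (auto intro: DERIV_subset)
    then have "(f has_real_derivative f' \<tau>) (at \<tau>)"
      using that t by (subst (asm) at_within_open) auto
    with le that show ?thesis by blast
  qed
  have "continuous_on {0..<T} f"
    by (rule DERIV_continuous_on) (rule deriv)
  then show "continuous_on {0..t} f"
    by (rule continuous_on_subset) (use t in auto)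
qed

lemma constant_from_start:
  fixes f f' :: "real \<Rightarrow> real"
  assumes "\<And>\<tau>. \<tau> \<in> {0..<T} \<Longrightarrow> (f has_real_derivative f' \<tau>) (at \<tau> within {0..<T})"
    and t: "t \<in> {0..<T}"
    and "\<And>\<tau>. 0 < \<tau> \<Longrightarrow> \<tau> < t \<Longrightarrow> f' \<tau> = 0"
  shows "f t = f 0"
proof (rule antisym)
  show "f t \<le> f 0"
    by (rule nonincreasing_from_start[of T f f', OF assms(1) t]) (auto simp: assms(3))
  have "- f t \<le> - f 0"
    by (rule nonincreasing_from_start[of T "\<lambda>t. - f t" "\<lambda>t. - f' t", OF _ t])
       (auto simp: assms(3) intro!: DERIV_minus assms(1))
  then show "f 0 \<le> f t" by simp
qed

text \<open>At the end point \<open>a\<close> differentiability lets the one-sided derivative decide. This is how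
  the smoothness of \<open>V\<close> gives \<open>V'(lam) = V''(lam) = 0\<close>.\<close>

lemma deriv_eq_0_of_eq_0_on_Ici:
  fixes g :: "real \<Rightarrow> real"
  assumes zero: "\<And>x. x \<ge> a \<Longrightarrow> g x = 0"
    and diff: "g differentiable (at x)" and x: "x \<ge> a"
  shows "deriv g x = 0"
proof (rule has_field_derivative_unique)
  have "(g has_real_derivative deriv g x) (at x)"
    using diff by (simp add: DERIV_deriv_iff_real_differentiable)
  then show "(g has_real_derivative deriv g x) (at x within {x..})"
    by (rule DERIV_subset) simp
  have "((\<lambda>_. 0) has_real_derivative 0) (at x within {x..})" by simp
  then show "(g has_real_derivative 0) (at x within {x..})"
    by (rule has_field_derivative_transform_within[where d = 1]) (use zero x in auto)
  show "at x within {x..} \<noteq> bot"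
    by (simp add: at_within_Ici_at_right)
qed

lemma antiderivative_on_Ici:
  fixes g :: "real \<Rightarrow> real"
  assumes cont: "continuous_on {0..} g" and t: "t \<ge> 0"
  shows "((\<lambda>x. integral {0..x} g) has_real_derivative g t) (at t within {0..})"
proof -
  have "((\<lambda>x. integral {0..x} g) has_real_derivative g t) (at t within {0..t + 1})"
    by (rule integral_has_real_derivative) (use t in \<open>auto intro: continuous_on_subset[OF cont]\<close>)
  moreover have "at t within {0..t + 1} = at t within {0..}"
    by (rule at_within_nhd[of t "{..<t + 1}"]) auto
  ultimately show ?thesis by simp
qed

lemma summation_by_parts:
  fixes w D :: "nat \<Rightarrow> real"
  assumes "n \<ge> 1"
  shows "(\<Sum>i=1..n. w i * (D i - D (i + 1))) =
    w 1 * D 1 - w n * D (n + 1) + (\<Sum>i=2..n. D i * (w i - w (i - 1)))"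
  using assms
proof (induction n rule: nat_induct_at_least)
  case base
  show ?case by (simp add: algebra_simps)
next
  case (Suc n)
  then show ?case by (simp add: algebra_simps)
qed

section \<open>The weighted speed error\<close>

definition rel_err :: "real \<Rightarrow> real \<Rightarrow> real \<Rightarrow> real" where
  "rel_err vmax y w = (w - y) / sqrt ((vmax - w) * w)"

lemma beta_pos:
  assumes "0 < w" "w < vmax" "0 < y" "y < vmax"
  shows "beta vmax w y > 0"
proof -
  have "vmax ^ 3 * (w + y) - 2 * vmax\<^sup>2 * y * w = vmax\<^sup>2 * (w * (vmax - y) + y * (vmax - w))"
    by (simp add: algebra_simps power2_eq_square power3_eq_cube)
  also have "\<dots> > 0" using assms by (intro mult_pos_pos add_pos_pos) auto
  finally show ?thesis using assms by (simp add: beta_def)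
qed

text \<open>The reason for the form of \<open>beta\<close>: it is the derivative of the weighted error with respect to
  the speed, rescaled so that the square root disappears. The reference speed \<open>y\<close> may move, too.\<close>

lemma rel_err_has_derivative:
  assumes w: "(w has_real_derivative w') (at t within S)"
    and y: "(y has_real_derivative y') (at t within S)"
    and range: "0 < w t" "w t < vmax"
  shows "((\<lambda>t. rel_err vmax (y t) (w t)) has_real_derivative
    beta vmax (w t) (y t) * sqrt ((vmax - w t) * w t) / vmax\<^sup>2 * w'
      - y' / sqrt ((vmax - w t) * w t)) (at t within S)"
proof -
  define q where "q = sqrt ((vmax - w t) * w t)"
  have pos: "(vmax - w t) * w t > 0" using range by simp
  then have q: "q > 0" "q * q = (vmax - w t) * w t" by (auto simp: q_def)
  have vmax: "vmax \<noteq> 0" using range by simp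
  have "q ^ 4 = (q * q) * (q * q)" by (simp add: power4_eq_xxxx)
  then have "2 * (vmax - w t)\<^sup>2 * (w t)\<^sup>2 = 2 * q ^ 4"
    unfolding q(2) by (simp add: power2_eq_square)
  then have beta: "beta vmax (w t) (y t) = vmax\<^sup>2 * (vmax * (w t + y t) - 2 * y t * w t) / (2 * q ^ 4)"
    by (simp add: beta_def algebra_simps power2_eq_square power3_eq_cube)
  have "((\<lambda>t. rel_err vmax (y t) (w t)) has_real_derivative
      ((w' - y') * q - (w t - y t) * (((vmax - w t) * w' - w' * w t) / (2 * q))) / (q * q)) (at t within S)"
    unfolding rel_err_def q_def using pos range
    by (auto intro!: derivative_eq_intros w y simp: field_simps)
  moreover have "((w' - y') * q - (w t - y t) * (((vmax - w t) * w' - w' * w t) / (2 * q))) / (q * q)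
    = beta vmax (w t) (y t) * q / vmax\<^sup>2 * w' - y' / q"
  proof -
    have "((w' - y') * q - (w t - y t) * (((vmax - w t) * w' - w' * w t) / (2 * q))) / (q * q)
      = (2 * w' * (q * q) - (w t - y t) * ((vmax - w t) * w' - w' * w t)) / (2 * q ^ 3) - y' / q"
      using q(1) by (simp add: field_simps power3_eq_cube)
    also have "2 * w' * (q * q) - (w t - y t) * ((vmax - w t) * w' - w' * w t)
      = (vmax * (w t + y t) - 2 * y t * w t) * w'"
      unfolding q(2) by (simp add: algebra_simps)
    also have "\<dots> / (2 * q ^ 3) = beta vmax (w t) (y t) * q / vmax\<^sup>2 * w'"
      unfolding beta using q(1) vmax by (simp add: field_simps power3_eq_cube power4_eq_xxxx)
    finally show ?thesis .
  qed
  ultimately show ?thesis by (simp add: q_def)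
qed

text \<open>The derivative in the speed is positive, because \<open>beta\<close> is.\<close>

lemma rel_err_inj:
  assumes "0 < y" "y < vmax" "0 < w1" "w1 < vmax" "0 < w2" "w2 < vmax"
    and eq: "rel_err vmax y w1 = rel_err vmax y w2"
  shows "w1 = w2"
proof -
  have less: "rel_err vmax y a < rel_err vmax y c" if "0 < a" "a < c" "c < vmax" for a c
  proof (rule DERIV_pos_imp_increasing[OF \<open>a < c\<close>])
    fix x assume x: "a \<le> x" "x \<le> c"
    have "((\<lambda>x. rel_err vmax y x) has_real_derivative
      beta vmax x y * sqrt ((vmax - x) * x) / vmax\<^sup>2 * 1 - 0 / sqrt ((vmax - x) * x)) (at x)"
      by (rule rel_err_has_derivative) (use x that in auto)
    moreover have "beta vmax x y * sqrt ((vmax - x) * x) / vmax\<^sup>2 > 0"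
      using x that assms(1,2) beta_pos[of x vmax y] by (intro divide_pos_pos mult_pos_pos) auto
    ultimately show "\<exists>d. (rel_err vmax y has_real_derivative d) (at x) \<and> 0 < d" by auto
  qed
  show ?thesis
    using less[of w1 w2] less[of w2 w1] assms by (metis less_irrefl linorder_neqE)
qed

text \<open>The geometric mean of \<open>vmax - w\<close> and \<open>w\<close> is at most their arithmetic mean \<open>vmax / 2\<close>.\<close>

lemma abs_dist_le_rel_err:
  assumes "0 < w" "w < vmax"
  shows "\<bar>w - y\<bar> \<le> vmax / 2 * \<bar>rel_err vmax y w\<bar>"
proof -
  have "(vmax - w) * w \<le> (vmax / 2)\<^sup>2"
    using zero_le_power2[of "w - vmax / 2"] by (simp add: power2_eq_square algebra_simps)
  then have le: "sqrt ((vmax - w) * w) \<le> vmax / 2" using assms by (intro real_le_lsqrt) auto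
  define q where "q = sqrt ((vmax - w) * w)"
  have "q > 0" using assms by (simp add: q_def)
  then have "\<bar>w - y\<bar> = q * \<bar>rel_err vmax y w\<bar>"
    by (simp add: rel_err_def q_def[symmetric])
  also have "\<dots> \<le> vmax / 2 * \<bar>rel_err vmax y w\<bar>" unfolding q_def by (rule mult_right_mono[OF le]) simp
  finally show ?thesis .
qed

text \<open>In terms of \<open>r = sqrt (w / (vmax - w))\<close> the weighted error of \<open>w = vmax r\<^sup>2 / (1 + r\<^sup>2)\<close> is
  \<open>((vmax - y) r - y / r) / vmax\<close>. Equating this with \<open>p\<close> gives a quadratic equation for \<open>r\<close>;
  its roots have the negative product \<open>- y / (vmax - y)\<close>, and \<open>odds_root\<close> is the positive one.\<close>

definition odds_root :: "real \<Rightarrow> real \<Rightarrow> real \<Rightarrow> real" where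
  "odds_root vmax y p =
     (vmax * p + sqrt ((vmax * p)\<^sup>2 + 4 * (vmax - y) * y)) / (2 * (vmax - y))"

definition speed_of_err :: "real \<Rightarrow> real \<Rightarrow> real \<Rightarrow> real" where
  "speed_of_err vmax y p =
     vmax * (odds_root vmax y p)\<^sup>2 / (1 + (odds_root vmax y p)\<^sup>2)"

context
  fixes vmax y :: real
  assumes y: "0 < y" "y < vmax"
begin

lemma odds_root_pos: "odds_root vmax y p > 0"
proof -
  have "sqrt ((vmax * p)\<^sup>2) < sqrt ((vmax * p)\<^sup>2 + 4 * (vmax - y) * y)"
    using y by (intro real_sqrt_less_mono) simp
  then show ?thesis using y by (simp add: odds_root_def)
qed

lemma odds_root_quadratic:
  "(vmax - y) * (odds_root vmax y p)\<^sup>2 - y = vmax * p * odds_root vmax y p"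
proof -
  define d where "d = sqrt ((vmax * p)\<^sup>2 + 4 * (vmax - y) * y)"
  have "d\<^sup>2 = (vmax * p)\<^sup>2 + 4 * (vmax - y) * y" using y by (simp add: d_def)
  moreover have "2 * (vmax - y) * odds_root vmax y p = vmax * p + d"
    using y by (simp add: odds_root_def d_def)
  then have "(2 * (vmax - y) * odds_root vmax y p - vmax * p)\<^sup>2 = d\<^sup>2" by simp
  ultimately have "4 * (vmax - y) * ((vmax - y) * (odds_root vmax y p)\<^sup>2 - y)
    = 4 * (vmax - y) * (vmax * p * odds_root vmax y p)"
    by (simp add: power2_eq_square algebra_simps)
  then show ?thesis using y by simp
qed

lemma speed_of_err_range: "0 < speed_of_err vmax y p" "speed_of_err vmax y p < vmax"
proof -
  have "1 + (odds_root vmax y p)\<^sup>2 > 0" by (simp add: add_pos_nonneg)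
  then show "0 < speed_of_err vmax y p" "speed_of_err vmax y p < vmax"
    using odds_root_pos[of p] y by (auto simp: speed_of_err_def field_simps)
qed

lemma rel_err_speed_of_err: "rel_err vmax y (speed_of_err vmax y p) = p"
proof -
  define r where "r = odds_root vmax y p"
  have r: "r > 0" using odds_root_pos by (simp add: r_def)
  have den: "1 + r\<^sup>2 > 0" by (simp add: add_pos_nonneg)
  have "(vmax - speed_of_err vmax y p) * speed_of_err vmax y p = (vmax * r / (1 + r\<^sup>2))\<^sup>2"
    using den by (simp add: speed_of_err_def r_def[symmetric] field_simps power2_eq_square)
  then have "sqrt ((vmax - speed_of_err vmax y p) * speed_of_err vmax y p) = vmax * r / (1 + r\<^sup>2)"
    using r den y by simp
  moreover have "speed_of_err vmax y p - y = ((vmax - y) * r\<^sup>2 - y) / (1 + r\<^sup>2)"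
    using den by (simp add: speed_of_err_def r_def[symmetric] field_simps)
  then have "speed_of_err vmax y p - y = vmax * p * r / (1 + r\<^sup>2)"
    using odds_root_quadratic[of p] by (simp add: r_def)
  ultimately show ?thesis using r den y by (simp add: rel_err_def)
qed

lemma speed_of_err_rel_err:
  "0 < w \<Longrightarrow> w < vmax \<Longrightarrow> speed_of_err vmax y (rel_err vmax y w) = w"
  by (rule rel_err_inj[OF y]) (auto simp: speed_of_err_range rel_err_speed_of_err)

lemma speed_of_err_has_derivative:
  defines "w \<equiv> speed_of_err vmax y"
  shows "(w has_real_derivative
    inverse (beta vmax (w p) y * sqrt ((vmax - w p) * w p) / vmax\<^sup>2)) (at p)"
proof (rule DERIV_inverse_function[where f = "rel_err vmax y" and a = "p - 1" and b = "p + 1"])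
  have range: "0 < w p" "w p < vmax" by (auto simp: w_def speed_of_err_range)
  have "((\<lambda>x. rel_err vmax y x) has_real_derivative
      beta vmax (w p) y * sqrt ((vmax - w p) * w p) / vmax\<^sup>2 * 1
        - 0 / sqrt ((vmax - w p) * w p)) (at (w p))"
    by (rule rel_err_has_derivative) (use range in auto)
  then show "(rel_err vmax y has_real_derivative
      beta vmax (w p) y * sqrt ((vmax - w p) * w p) / vmax\<^sup>2) (at (w p))" by simp
  show "beta vmax (w p) y * sqrt ((vmax - w p) * w p) / vmax\<^sup>2 \<noteq> 0"
    using range y beta_pos[OF range y] by simp
  have "1 + (odds_root vmax y p)\<^sup>2 \<noteq> 0" by (metis add_pos_nonneg less_irrefl zero_le_power2 zero_less_one)
  then show "isCont w p"
    using y unfolding w_def speed_of_err_def[abs_def] odds_root_def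
    by (intro continuous_intros) auto
qed (auto simp: w_def rel_err_speed_of_err)

end

section \<open>The closed-loop system\<close>

locale open_road =
  fixes n :: nat and L lam vmax vstar \<mu> :: real and V b :: "real \<Rightarrow> real"
  assumes n: "n \<ge> 2" and lam: "L < lam"
    and vmax: "0 < vmax" and vstar: "0 < vstar" "vstar < vmax" and mu: "0 < \<mu>"
    and V_diff: "\<And>x. x > L \<Longrightarrow> V differentiable (at x)"
    and dV_diff: "\<And>x. x > L \<Longrightarrow> deriv V differentiable (at x)"
    and V_nonneg: "\<And>x. x > L \<Longrightarrow> V x \<ge> 0"
    and V_zero: "\<And>x. x \<ge> lam \<Longrightarrow> V x = 0"
    and V_deriv: "\<And>x. L < x \<Longrightarrow> x < lam \<Longrightarrow> deriv V x < 0"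
    and b_diff: "\<And>x. b differentiable (at x)"
    and b_range: "\<And>x. b x \<in> {vstar - vmax<..<vstar}"
    and b_zero: "b 0 = 0"
    and b_sign: "\<And>x. x \<noteq> 0 \<Longrightarrow> x * b x > 0"
begin

abbreviation "F \<equiv> F_ctrl n vmax vstar \<mu> V b"
abbreviation "f \<equiv> f_ref n vstar V b"
abbreviation "solution \<equiv> is_solution n L vmax vstar \<mu> V b"

lemma state_space_iff:
  "(s, v) \<in> state_space n L vmax \<longleftrightarrow>
     (\<forall>i\<in>{2..n}. s i > L) \<and> (\<forall>i\<in>{1..n}. 0 < v i \<and> v i < vmax)"
  using n by (auto simp: state_space_def)

lemma f_range: "0 < f i s" "f i s < vmax"
  using b_range[of "dV n V s (i + 1) - dV n V s i"] by (auto simp: f_ref_def)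

text \<open>Beyond \<open>lam\<close> the potential vanishes together with its first two derivatives, even at \<open>lam\<close>
  itself, so vehicles this far apart do not interact and only \<open>b 0 = 0\<close> enters the reference speed.\<close>

lemma far_apart:
  assumes "\<forall>i\<in>{2..n}. s i \<ge> lam"
  shows "dV n V s i = 0" "ddV n V s i = 0" "f i s = vstar" "Z_term n vmax V b i s v = 0"
proof -
  have d1: "deriv V x = 0" if "x \<ge> lam" for x
    by (rule deriv_eq_0_of_eq_0_on_Ici[of lam]) (use that lam V_zero V_diff in auto)
  have d2: "deriv (deriv V) x = 0" if "x \<ge> lam" for x
    by (rule deriv_eq_0_of_eq_0_on_Ici[of lam]) (use that lam d1 dV_diff in auto)
  have D: "dV n V s i = 0" "ddV n V s i = 0" for i
    using assms d1 d2 by (auto simp: dV_def ddV_def)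
  show "dV n V s i = 0" "ddV n V s i = 0" "f i s = vstar" "Z_term n vmax V b i s v = 0"
    by (auto simp: D f_ref_def Z_term_def b_zero)
qed

lemma V_eq_0_iff:
  assumes "x > L"
  shows "V x = 0 \<longleftrightarrow> x \<ge> lam"
proof
  assume "V x = 0"
  show "x \<ge> lam"
  proof (rule ccontr)
    assume "\<not> x \<ge> lam"
    have dV: "(V has_real_derivative deriv V z) (at z)" if "z > L" for z
      using V_diff[OF that] by (simp add: DERIV_deriv_iff_real_differentiable)
    have "V x > V lam"
    proof (rule DERIV_neg_imp_decreasing_open[where f = V])
      show "x < lam" using \<open>\<not> x \<ge> lam\<close> by simp
      show "\<exists>d. (V has_real_derivative d) (at z) \<and> d < 0" if "x < z" "z < lam" for z
        using dV[of z] V_deriv[of z] that assms by auto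
      show "continuous_on {x..lam} V"
        using assms by (intro continuous_at_imp_continuous_on ballI DERIV_isCont[OF dV]) simp
    qed
    with \<open>V x = 0\<close> V_zero show False by simp
  qed
qed (use V_zero in auto)

text \<open>The left-hand side is the rate of change of the weighted error that
  \<open>rel_err_has_derivative\<close> predicts for the acceleration \<open>F\<close> when the reference speed changes at
  the rate \<open>Z / vmax\<^sup>2\<close>. The feedback law is this equation solved for \<open>F\<close>.\<close>

lemma closed_loop_err_rate:
  assumes "0 < v i" "v i < vmax"
  defines "q \<equiv> sqrt ((vmax - v i) * v i)"
  shows "beta vmax (v i) (f i s) * q / vmax\<^sup>2 * F i s v - Z_term n vmax V b i s v / vmax\<^sup>2 / q
    = - \<mu> * rel_err vmax (f i s) (v i) + q / vmax\<^sup>2 * (dV n V s i - dV n V s (i + 1))"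
proof -
  have q: "q > 0" "v i * (vmax - v i) = q * q" using assms(1,2) by (auto simp: q_def)
  have "beta vmax (v i) (f i s) > 0" by (rule beta_pos[OF assms(1,2) f_range])
  then show ?thesis
    using q(1) vmax unfolding F_ctrl_def q(2) rel_err_def q_def[symmetric]
    by (simp add: field_simps power2_eq_square)
qed

text \<open>\<open>Z_term / vmax\<^sup>2\<close> is the time derivative of the reference speed, so the previous identity
  turns into a differential equation for the weighted errors, valid on the whole state space.\<close>

lemma solution_rel_err_has_derivative:
  assumes sol: "solution J s v" and t: "t \<in> J" and i: "i \<in> {1..n}"
  shows "((\<lambda>t. rel_err vmax (f i (s t)) (v t i)) has_real_derivative
    - \<mu> * rel_err vmax (f i (s t)) (v t i)
    + sqrt ((vmax - v t i) * v t i) / vmax\<^sup>2 * (dV n V (s t) i - dV n V (s t) (i + 1)))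
    (at t within J)"
proof -
  have range: "0 < v t i" "v t i < vmax" "\<And>j. j \<in> {2..n} \<Longrightarrow> s t j > L"
    using sol t i by (auto simp: is_solution_def state_space_iff)
  have dv: "((\<lambda>t. v t i) has_real_derivative F i (s t) (v t)) (at t within J)"
    using sol t i by (auto simp: is_solution_def)
  have dD: "((\<lambda>t. dV n V (s t) j) has_real_derivative
      ddV n V (s t) j * (v t (j - 1) - v t j)) (at t within J)" for j
  proof (cases "j \<in> {2..n}")
    case True
    then have "((\<lambda>t. s t j) has_real_derivative v t (j - 1) - v t j) (at t within J)"
      using sol t by (auto simp: is_solution_def)
    moreover have "(deriv V has_real_derivative deriv (deriv V) (s t j)) (at (s t j))"
      using dV_diff range(3)[OF True] by (simp add: DERIV_deriv_iff_real_differentiable)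
    ultimately show ?thesis using True by (simp add: dV_def ddV_def DERIV_chain2[where f = "deriv V"])
  qed (auto simp: dV_def ddV_def)
  have db: "(b has_real_derivative deriv b x) (at x)" for x
    using b_diff by (simp add: DERIV_deriv_iff_real_differentiable)
  have "((\<lambda>t. f i (s t)) has_real_derivative 0 - deriv b (dV n V (s t) (i + 1) - dV n V (s t) i)
      * (ddV n V (s t) (i + 1) * (v t (i + 1 - 1) - v t (i + 1))
         - ddV n V (s t) i * (v t (i - 1) - v t i))) (at t within J)"
    unfolding f_ref_def by (intro DERIV_diff DERIV_const DERIV_chain2[OF db] dD)
  moreover have "0 - deriv b (dV n V (s t) (i + 1) - dV n V (s t) i)
      * (ddV n V (s t) (i + 1) * (v t (i + 1 - 1) - v t (i + 1))
         - ddV n V (s t) i * (v t (i - 1) - v t i))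
    = Z_term n vmax V b i (s t) (v t) / vmax\<^sup>2"
    using vmax by (simp add: Z_term_def)
  ultimately have df: "((\<lambda>t. f i (s t)) has_real_derivative
      Z_term n vmax V b i (s t) (v t) / vmax\<^sup>2) (at t within J)" by simp
  show ?thesis
    using rel_err_has_derivative[OF dv df range(1,2)] closed_loop_err_rate[where v = "v t" and s = "s t", OF range(1,2)]
    by simp
qed

section \<open>Solutions stay spread out\<close>

text \<open>A Lyapunov function: the squared weighted errors play the role of kinetic energies and \<open>V\<close>
  that of an interaction potential.\<close>

definition energy :: "(nat \<Rightarrow> real) \<Rightarrow> (nat \<Rightarrow> real) \<Rightarrow> real" where
  "energy s v = vmax\<^sup>2 / 2 * (\<Sum>i=1..n. (rel_err vmax (f i s) (v i))\<^sup>2) + (\<Sum>i=2..n. V (s i))"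

text \<open>In the derivative of the energy, the interaction terms of the error equations contribute
  \<open>\<Sum>i. (v\<^sub>i - f\<^sub>i) (V'(s\<^sub>i) - V'(s\<^sub>i\<^sub>+\<^sub>1))\<close>. Writing \<open>v\<^sub>i - f\<^sub>i = (v\<^sub>i - vstar) + b (x\<^sub>i)\<close> with
  \<open>x\<^sub>i = V'(s\<^sub>i\<^sub>+\<^sub>1) - V'(s\<^sub>i)\<close>, the part with \<open>v\<^sub>i - vstar\<close> cancels against the derivative of the
  potential by summation by parts. What remains is
  \<open>- (\<Sum>i. x\<^sub>i b (x\<^sub>i)) - \<mu> vmax\<^sup>2 (\<Sum>i. \<psi>\<^sub>i\<^sup>2)\<close>, and \<open>b\<close> has the sign of its argument.\<close>

lemma energy_le_initial:
  assumes sol: "solution {0..<T} s v" and t: "t \<in> {0..<T}"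
  shows "energy (s t) (v t) \<le> energy (s 0) (v 0)"
proof (rule nonincreasing_from_start[of T "\<lambda>t. energy (s t) (v t)", OF _ t])
  let ?J = "{0..<T}"
  define D where "D t i = dV n V (s t) i" for t i
  define \<psi> where "\<psi> t i = rel_err vmax (f i (s t)) (v t i)" for t i
  define \<psi>' where "\<psi>' t i = - \<mu> * \<psi> t i + sqrt ((vmax - v t i) * v t i) / vmax\<^sup>2 * (D t i - D t (i + 1))" for t i
  define E' where "E' t = vmax\<^sup>2 / 2 * (\<Sum>i=1..n. 2 * \<psi> t i * \<psi>' t i)
      + (\<Sum>i=2..n. D t i * (v t (i - 1) - v t i))" for t
  show "((\<lambda>t. energy (s t) (v t)) has_real_derivative E' t) (at t within ?J)" if t: "t \<in> ?J" for t
  proof -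
    have "((\<lambda>t. V (s t i)) has_real_derivative D t i * (v t (i - 1) - v t i)) (at t within ?J)"
      if i: "i \<in> {2..n}" for i
    proof -
      have "s t i > L" "((\<lambda>t. s t i) has_real_derivative v t (i - 1) - v t i) (at t within ?J)"
        using sol t i by (auto simp: is_solution_def state_space_iff)
      moreover from this have "(V has_real_derivative deriv V (s t i)) (at (s t i))"
        using V_diff by (simp add: DERIV_deriv_iff_real_differentiable)
      ultimately show ?thesis using i by (simp add: D_def dV_def DERIV_chain2[where f = V])
    qed
    moreover have "((\<lambda>t. (\<psi> t i)\<^sup>2) has_real_derivative 2 * \<psi> t i * \<psi>' t i) (at t within ?J)"
      if "i \<in> {1..n}" for i
    proof -
      have "((\<lambda>t. \<psi> t i) has_real_derivative \<psi>' t i) (at t within ?J)"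
        unfolding \<psi>'_def \<psi>_def D_def by (rule solution_rel_err_has_derivative[OF sol t that])
      then show ?thesis by (auto intro!: derivative_eq_intros)
    qed
    ultimately show ?thesis
      unfolding energy_def E'_def \<psi>_def[symmetric]
      by (intro DERIV_add DERIV_cmult DERIV_sum) auto
  qed
  show "E' \<tau> \<le> 0" if \<tau>: "0 < \<tau>" "\<tau> < t" for \<tau>
  proof -
    define x where "x i = D \<tau> (i + 1) - D \<tau> i" for i
    have range: "0 < v \<tau> i" "v \<tau> i < vmax" if "i \<in> {1..n}" for i
      using sol \<tau> t that by (auto simp: is_solution_def state_space_iff)
    have summand: "vmax\<^sup>2 / 2 * (2 * \<psi> \<tau> i * \<psi>' \<tau> i)
        = (v \<tau> i - vstar) * (D \<tau> i - D \<tau> (i + 1)) - x i * b (x i) - \<mu> * vmax\<^sup>2 * (\<psi> \<tau> i)\<^sup>2"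
      if i: "i \<in> {1..n}" for i
    proof -
      define q where "q = sqrt ((vmax - v \<tau> i) * v \<tau> i)"
      have "q > 0" using range[OF i] by (simp add: q_def)
      then have err: "\<psi> \<tau> i * q = v \<tau> i - vstar + b (x i)"
        by (simp add: \<psi>_def rel_err_def q_def[symmetric] f_ref_def x_def D_def)
      have "vmax\<^sup>2 / 2 * (2 * \<psi> \<tau> i * \<psi>' \<tau> i)
          = (\<psi> \<tau> i * q) * (D \<tau> i - D \<tau> (i + 1)) - \<mu> * vmax\<^sup>2 * (\<psi> \<tau> i)\<^sup>2"
        using vmax unfolding \<psi>'_def q_def[symmetric] by (simp add: field_simps power2_eq_square)
      then show ?thesis unfolding err by (simp add: x_def algebra_simps)
    qed
    have "(\<Sum>i=1..n. (v \<tau> i - vstar) * (D \<tau> i - D \<tau> (i + 1)))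
        = - (\<Sum>i=2..n. D \<tau> i * (v \<tau> (i - 1) - v \<tau> i))"
      using n by (subst summation_by_parts)
        (auto simp: D_def dV_def sum_negf[symmetric] algebra_simps intro!: sum.cong)
    moreover have "vmax\<^sup>2 / 2 * (\<Sum>i=1..n. 2 * \<psi> \<tau> i * \<psi>' \<tau> i)
        = (\<Sum>i=1..n. (v \<tau> i - vstar) * (D \<tau> i - D \<tau> (i + 1)))
          - (\<Sum>i=1..n. x i * b (x i)) - (\<Sum>i=1..n. \<mu> * vmax\<^sup>2 * (\<psi> \<tau> i)\<^sup>2)"
      unfolding sum_distrib_left sum_subtractf[symmetric] by (rule sum.cong[OF refl summand])
    moreover have "(\<Sum>i=1..n. x i * b (x i)) \<ge> 0"
      using b_sign by (intro sum_nonneg) (metis less_eq_real_def mult_zero_left)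
    moreover have "(\<Sum>i=1..n. \<mu> * vmax\<^sup>2 * (\<psi> \<tau> i)\<^sup>2) \<ge> 0"
      using mu by (intro sum_nonneg) simp
    ultimately show ?thesis unfolding E'_def by linarith
  qed
qed

text \<open>The energy is zero initially, hence always, and \<open>V\<close> is zero only beyond \<open>lam\<close>. Here the
  spacings may start at \<open>lam\<close> itself, from where continuity alone cannot exclude that they
  become smaller.\<close>

lemma stays_apart_from_equilibrium:
  assumes sol: "solution {0..<T} s v" and t: "t \<in> {0..<T}"
    and equilibrium: "\<And>i. i \<in> {1..n} \<Longrightarrow> v 0 i = vstar" "\<And>i. i \<in> {2..n} \<Longrightarrow> s 0 i \<ge> lam"
  shows "\<forall>i\<in>{2..n}. s t i \<ge> lam"
proof
  fix i assume i: "i \<in> {2..n}"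
  have L: "\<And>j. j \<in> {2..n} \<Longrightarrow> s t j > L"
    using sol t by (auto simp: is_solution_def state_space_iff)
  have "energy (s 0) (v 0) = 0"
    using equilibrium by (simp add: energy_def rel_err_def far_apart V_zero)
  with energy_le_initial[OF sol t] have "energy (s t) (v t) \<le> 0" by simp
  moreover have "0 \<le> vmax\<^sup>2 / 2 * (\<Sum>i=1..n. (rel_err vmax (f i (s t)) (v t i))\<^sup>2)"
    by (intro mult_nonneg_nonneg sum_nonneg) auto
  ultimately have "(\<Sum>i=2..n. V (s t i)) \<le> 0" by (simp add: energy_def)
  moreover have "V (s t i) \<le> (\<Sum>i=2..n. V (s t i))"
    using i L V_nonneg by (intro member_le_sum) auto
  moreover have "V (s t i) \<ge> 0" using V_nonneg L[OF i] .
  ultimately have "V (s t i) = 0" by linarith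
  then show "s t i \<ge> lam" using V_eq_0_iff L[OF i] by simp
qed

text \<open>Without interaction the error equation is linear, so multiplying by \<open>exp (\<mu> t)\<close> gives a
  constant. The spacings are controlled only strictly before \<open>t\<close>, which makes the lemma applicable
  at a time when they might just become too small.\<close>

lemma rel_err_decays:
  assumes sol: "solution {0..<T} s v" and t: "t \<in> {0..<T}"
    and apart: "\<And>\<tau>. 0 \<le> \<tau> \<Longrightarrow> \<tau> < t \<Longrightarrow> \<forall>i\<in>{2..n}. s \<tau> i \<ge> lam"
    and i: "i \<in> {1..n}"
  shows "rel_err vmax vstar (v t i) = rel_err vmax vstar (v 0 i) * exp (- \<mu> * t)"
proof -
  let ?\<psi> = "\<lambda>t. rel_err vmax vstar (v t i)"
  define \<psi>' where "\<psi>' t = beta vmax (v t i) vstar * sqrt ((vmax - v t i) * v t i) / vmax\<^sup>2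
    * F i (s t) (v t)" for t
  have range: "0 < v \<tau> i" "v \<tau> i < vmax" if "\<tau> \<in> {0..<T}" for \<tau>
    using sol that i by (auto simp: is_solution_def state_space_iff)
  have d\<psi>: "(?\<psi> has_real_derivative \<psi>' \<tau>) (at \<tau> within {0..<T})" if \<tau>: "\<tau> \<in> {0..<T}" for \<tau>
  proof -
    have "((\<lambda>t. v t i) has_real_derivative F i (s \<tau>) (v \<tau>)) (at \<tau> within {0..<T})"
      using sol \<tau> i by (auto simp: is_solution_def)
    from rel_err_has_derivative[OF this DERIV_const range[OF \<tau>]] show ?thesis
      by (simp add: \<psi>'_def)
  qed
  have "?\<psi> t * exp (\<mu> * t) = ?\<psi> 0 * exp (\<mu> * 0)"
  proof (rule constant_from_start[of T _ "\<lambda>t. \<psi>' t * exp (\<mu> * t) + exp (\<mu> * t) * \<mu> * ?\<psi> t", OF _ t])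
    show "((\<lambda>t. ?\<psi> t * exp (\<mu> * t)) has_real_derivative
      \<psi>' \<tau> * exp (\<mu> * \<tau>) + exp (\<mu> * \<tau>) * \<mu> * ?\<psi> \<tau>) (at \<tau> within {0..<T})"
      if "\<tau> \<in> {0..<T}" for \<tau>
      by (auto intro!: derivative_eq_intros d\<psi>[OF that])
    show "\<psi>' \<tau> * exp (\<mu> * \<tau>) + exp (\<mu> * \<tau>) * \<mu> * ?\<psi> \<tau> = 0" if \<tau>: "0 < \<tau>" "\<tau> < t" for \<tau>
    proof -
      have "\<forall>i\<in>{2..n}. s \<tau> i \<ge> lam" using apart \<tau> by simp
      note far_apart[OF this]
      then have "\<psi>' \<tau> = - \<mu> * ?\<psi> \<tau>"
        using closed_loop_err_rate[where v = "v \<tau>" and s = "s \<tau>" and i = i] range[of \<tau>] \<tau> t by (simp add: \<psi>'_def)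
      then show ?thesis by simp
    qed
  qed
  then have "?\<psi> t * exp (\<mu> * t) * exp (- \<mu> * t) = ?\<psi> 0 * exp (- \<mu> * t)" by simp
  then show ?thesis by (simp add: exp_minus field_simps)
qed

text \<open>Two neighbouring speeds differ by at most \<open>vmax * \<Gamma> * exp (- \<mu> * \<tau>)\<close>, whose integral from
  \<open>0\<close> to \<open>t\<close> is \<open>vmax / \<mu> * \<Gamma> * (1 - exp (- \<mu> * t))\<close>. The part of the reserve
  \<open>vmax / \<mu> * \<Gamma>\<close> that is not yet used up at time \<open>t\<close> is kept in the conclusion, since it makes
  the bound strict for \<open>\<Gamma> > 0\<close>.\<close>

lemma spacing_lower_bound:
  fixes s v :: "real \<Rightarrow> nat \<Rightarrow> real"
  assumes ds: "\<And>\<tau>. \<tau> \<in> {0..<T} \<Longrightarrow>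
      ((\<lambda>t. s t i) has_real_derivative v \<tau> (i - 1) - v \<tau> i) (at \<tau> within {0..<T})"
    and t: "t \<in> {0..<T}"
    and v: "\<And>\<tau> j. 0 < \<tau> \<Longrightarrow> \<tau> < t \<Longrightarrow> j \<in> {i - 1, i} \<Longrightarrow>
      \<bar>v \<tau> j - vstar\<bar> \<le> vmax / 2 * \<Gamma> * exp (- \<mu> * \<tau>)"
    and s0: "s 0 i \<ge> lam + vmax / \<mu> * \<Gamma>"
  shows "s t i \<ge> lam + vmax / \<mu> * \<Gamma> * exp (- \<mu> * t)"
proof -
  have "vmax / \<mu> * \<Gamma> * exp (- \<mu> * t) - s t i \<le> vmax / \<mu> * \<Gamma> * exp (- \<mu> * 0) - s 0 i"
  proof (rule nonincreasing_from_start[of T _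
      "\<lambda>\<tau>. - (vmax * \<Gamma> * exp (- \<mu> * \<tau>)) - (v \<tau> (i - 1) - v \<tau> i)", OF _ t])
    show "((\<lambda>t. vmax / \<mu> * \<Gamma> * exp (- \<mu> * t) - s t i) has_real_derivative
      - (vmax * \<Gamma> * exp (- \<mu> * \<tau>)) - (v \<tau> (i - 1) - v \<tau> i)) (at \<tau> within {0..<T})"
      if "\<tau> \<in> {0..<T}" for \<tau>
      using mu by (auto intro!: derivative_eq_intros ds[OF that])
    show "- (vmax * \<Gamma> * exp (- \<mu> * \<tau>)) - (v \<tau> (i - 1) - v \<tau> i) \<le> 0" if "0 < \<tau>" "\<tau> < t" for \<tau>
    proof -
      have "\<bar>v \<tau> i - vstar\<bar> \<le> vmax / 2 * \<Gamma> * exp (- \<mu> * \<tau>)"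
        "\<bar>v \<tau> (i - 1) - vstar\<bar> \<le> vmax / 2 * \<Gamma> * exp (- \<mu> * \<tau>)"
        using v that by auto
      then show ?thesis by linarith
    qed
  qed
  with s0 show ?thesis by simp
qed

text \<open>Here \<open>(s, v)\<close> is an arbitrary solution, a priori free to enter the region of interaction.\<close>

lemma stays_apart:
  assumes sol: "solution {0..<T} s v"
    and err: "\<And>i. i \<in> {1..n} \<Longrightarrow> \<bar>rel_err vmax vstar (v 0 i)\<bar> \<le> \<Gamma>"
    and s0: "\<And>i. i \<in> {2..n} \<Longrightarrow> s 0 i \<ge> lam + vmax / \<mu> * \<Gamma>"
    and t: "t \<in> {0..<T}"
  shows "\<forall>i\<in>{2..n}. s t i \<ge> lam"
proof -
  have init: "0 < v 0 i" "v 0 i < vmax" if "i \<in> {1..n}" for i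
    using sol t that by (auto simp: is_solution_def state_space_iff)
  have "0 \<le> \<bar>rel_err vmax vstar (v 0 1)\<bar>" by simp
  also have "\<dots> \<le> \<Gamma>" using err n by simp
  finally have "\<Gamma> \<ge> 0" .
  then consider "\<Gamma> = 0" | "\<Gamma> > 0" by linarith
  then show ?thesis
  proof cases
    case 1
    show ?thesis
    proof (rule stays_apart_from_equilibrium[OF sol t])
      show "v 0 i = vstar" if "i \<in> {1..n}" for i
        using abs_dist_le_rel_err[OF init[OF that], of vstar] err[OF that] 1 by simp
      show "s 0 i \<ge> lam" if "i \<in> {2..n}" for i
        using s0[OF that] 1 by simp
    qed
  next
    case 2
    have bound: "s u i > lam"
      if u: "u \<in> {0..<T}" and apart: "\<And>\<tau>. 0 \<le> \<tau> \<Longrightarrow> \<tau> < u \<Longrightarrow> \<forall>i\<in>{2..n}. s \<tau> i \<ge> lam"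
        and i: "i \<in> {2..n}" for u i
    proof -
      have "s u i \<ge> lam + vmax / \<mu> * \<Gamma> * exp (- \<mu> * u)"
      proof (rule spacing_lower_bound[where T = T and s = s and v = v])
        show "((\<lambda>t. s t i) has_real_derivative v \<tau> (i - 1) - v \<tau> i) (at \<tau> within {0..<T})"
          if "\<tau> \<in> {0..<T}" for \<tau>
          using sol i that by (auto simp: is_solution_def)
        fix \<tau> j assume \<tau>: "0 < \<tau>" "\<tau> < u" and "j \<in> {i - 1, i}"
        then have j: "j \<in> {1..n}" using i by auto
        have \<tau>T: "\<tau> \<in> {0..<T}" using \<tau> u by auto
        have "0 < v \<tau> j" "v \<tau> j < vmax"
          using sol \<tau>T j by (auto simp: is_solution_def state_space_iff)
        then have "\<bar>v \<tau> j - vstar\<bar> \<le> vmax / 2 * \<bar>rel_err vmax vstar (v \<tau> j)\<bar>"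
          by (rule abs_dist_le_rel_err)
        also have "rel_err vmax vstar (v \<tau> j) = rel_err vmax vstar (v 0 j) * exp (- \<mu> * \<tau>)"
          by (rule rel_err_decays[OF sol \<tau>T _ j]) (use apart \<tau> in auto)
        also have "vmax / 2 * \<bar>\<dots>\<bar> \<le> vmax / 2 * (\<Gamma> * exp (- \<mu> * \<tau>))"
          using vmax err[OF j] by (intro mult_left_mono) (auto simp: abs_mult)
        finally show "\<bar>v \<tau> j - vstar\<bar> \<le> vmax / 2 * \<Gamma> * exp (- \<mu> * \<tau>)" by simp
      qed (use u s0 i in auto)
      moreover have "vmax / \<mu> * \<Gamma> * exp (- \<mu> * u) > 0" using vmax mu 2 by simp
      ultimately show ?thesis by linarith
    qed
    \<comment> \<open>the times at which some spacing is not above \<open>lam\<close>; a first such time contradicts \<open>bound\<close>\<close>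
    define A where "A = (\<Union>i\<in>{2..n}. {u \<in> {0..t}. s u i \<le> lam})"
    have cont: "continuous_on {0..t} (\<lambda>t. s t i)" if "i \<in> {2..n}" for i
    proof -
      have "continuous_on {0..<T} (\<lambda>t. s t i)"
        by (rule DERIV_continuous_on[where D = "\<lambda>\<tau>. v \<tau> (i - 1) - v \<tau> i"])
           (use sol that in \<open>auto simp: is_solution_def\<close>)
      then show ?thesis by (rule continuous_on_subset) (use t in auto)
    qed
    have "closed {u \<in> {0..t}. s u i \<le> lam}" if "i \<in> {2..n}" for i
      using continuous_closed_preimage[OF cont[OF that] closed_atLeastAtMost closed_atMost[of lam]]
      by (simp add: vimage_def Int_def)
    then have "closed A" unfolding A_def by (intro closed_UN) auto
    have "A = {}"
    proof (rule ccontr)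
      assume "A \<noteq> {}"
      have "bdd_below A" by (auto simp: A_def bdd_below_def)
      define u where "u = Inf A"
      have "u \<in> A"
        unfolding u_def using \<open>A \<noteq> {}\<close> \<open>bdd_below A\<close> \<open>closed A\<close> by (rule closed_contains_Inf)
      then obtain i where i: "i \<in> {2..n}" "s u i \<le> lam" and u: "u \<in> {0..t}" by (auto simp: A_def)
      have "\<forall>i\<in>{2..n}. s \<tau> i \<ge> lam" if \<tau>: "0 \<le> \<tau>" "\<tau> < u" for \<tau>
      proof -
        have "\<tau> \<notin> A"
          using \<tau> cInf_lower[OF _ \<open>bdd_below A\<close>, of \<tau>] by (auto simp: u_def)
        then show ?thesis using \<tau> u by (auto simp: A_def)
      qed
      then have "s u i > lam" using bound[of u i] u t i by auto
      with i show False by simp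
    qed
    then show ?thesis using t by (force simp: A_def)
  qed
qed

section \<open>The explicit solution\<close>

text \<open>The weighted errors of the solution have to be their initial values times \<open>exp (- \<mu> t)\<close>;
  inverting the weighting gives the speeds.\<close>

definition speed :: "(nat \<Rightarrow> real) \<Rightarrow> real \<Rightarrow> nat \<Rightarrow> real" where
  "speed v0 t i = speed_of_err vmax vstar (rel_err vmax vstar (v0 i) * exp (- \<mu> * t))"

definition gap :: "(nat \<Rightarrow> real) \<Rightarrow> (nat \<Rightarrow> real) \<Rightarrow> real \<Rightarrow> nat \<Rightarrow> real" where
  "gap s0 v0 t i = s0 i + integral {0..t} (\<lambda>\<tau>. speed v0 \<tau> (i - 1) - speed v0 \<tau> i)"

lemma speed_range: "0 < speed v0 t i" "speed v0 t i < vmax"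
  using speed_of_err_range[OF vstar] by (auto simp: speed_def)

lemma rel_err_speed:
  "rel_err vmax vstar (speed v0 t i) = rel_err vmax vstar (v0 i) * exp (- \<mu> * t)"
  using rel_err_speed_of_err[OF vstar] by (simp add: speed_def)

lemma speed_dist_le:
  assumes "\<bar>rel_err vmax vstar (v0 i)\<bar> \<le> \<Gamma>"
  shows "\<bar>speed v0 t i - vstar\<bar> \<le> vmax / 2 * \<Gamma> * exp (- \<mu> * t)"
proof -
  have "\<bar>speed v0 t i - vstar\<bar> \<le> vmax / 2 * \<bar>rel_err vmax vstar (speed v0 t i)\<bar>"
    by (rule abs_dist_le_rel_err[OF speed_range])
  also have "\<dots> \<le> vmax / 2 * (\<Gamma> * exp (- \<mu> * t))"
    unfolding rel_err_speed using vmax assms by (intro mult_left_mono) (auto simp: abs_mult)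
  finally show ?thesis by simp
qed

lemma speed_has_derivative:
  assumes "\<forall>i\<in>{2..n}. s i \<ge> lam"
  shows "((\<lambda>t. speed v0 t i) has_real_derivative F i s (speed v0 t)) (at t)"
proof -
  let ?w = "speed v0 t i"
  define c where "c = beta vmax ?w vstar * sqrt ((vmax - ?w) * ?w) / vmax\<^sup>2"
  have "c > 0"
    unfolding c_def using beta_pos[OF speed_range vstar] speed_range vmax
    by (intro divide_pos_pos mult_pos_pos) auto
  have "((\<lambda>t. speed v0 t i) has_real_derivative
      inverse c * (- \<mu> * (rel_err vmax vstar (v0 i) * exp (- \<mu> * t)))) (at t)"
    unfolding c_def speed_def
    by (rule DERIV_chain2[OF speed_of_err_has_derivative[OF vstar]])
       (auto intro!: derivative_eq_intros)
  moreover have "c * F i s (speed v0 t) = - \<mu> * rel_err vmax vstar ?w"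
    using closed_loop_err_rate[where v = "speed v0 t" and i = i and s = s, OF speed_range] far_apart[OF assms]
    by (simp add: c_def)
  then have "F i s (speed v0 t) = inverse c * (- \<mu> * (rel_err vmax vstar (v0 i) * exp (- \<mu> * t)))"
    using \<open>c > 0\<close> by (simp add: rel_err_speed field_simps)
  ultimately show ?thesis by simp
qed

lemma continuous_on_speed: "continuous_on S (\<lambda>t. speed v0 t i)"
  \<comment> \<open>\<open>speed\<close> does not refer to the spacings, so any spread-out configuration serves to
    differentiate it\<close>
  by (intro continuous_at_imp_continuous_on ballI DERIV_isCont[OF speed_has_derivative[of "\<lambda>_. lam"]])
     simp

lemma gap_has_derivative:
  assumes "t \<ge> 0"
  shows "((\<lambda>t. gap s0 v0 t i) has_real_derivative speed v0 t (i - 1) - speed v0 t i)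
    (at t within {0..})"
proof -
  have "((\<lambda>t. s0 i + integral {0..t} (\<lambda>\<tau>. speed v0 \<tau> (i - 1) - speed v0 \<tau> i))
      has_real_derivative 0 + (speed v0 t (i - 1) - speed v0 t i)) (at t within {0..})"
    by (intro DERIV_add DERIV_const antiderivative_on_Ici assms continuous_on_diff continuous_on_speed)
  then show ?thesis by (simp add: gap_def)
qed

context
  fixes s0 v0 :: "nat \<Rightarrow> real" and \<Gamma> :: real
  assumes err: "\<forall>i\<in>{1..n}. \<bar>rel_err vmax vstar (v0 i)\<bar> \<le> \<Gamma>"
    and s0: "\<forall>i\<in>{2..n}. s0 i \<ge> lam + vmax / \<mu> * \<Gamma>"
    and v0: "\<forall>i\<in>{1..n}. 0 < v0 i \<and> v0 i < vmax"
begin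

lemma gap_ge:
  assumes t: "t \<ge> 0" and i: "i \<in> {2..n}"
  shows "gap s0 v0 t i \<ge> lam"
proof -
  have "\<bar>rel_err vmax vstar (v0 1)\<bar> \<le> \<Gamma>" using err n by simp
  then have "\<Gamma> \<ge> 0" by linarith
  have "gap s0 v0 t i \<ge> lam + vmax / \<mu> * \<Gamma> * exp (- \<mu> * t)"
  proof (rule spacing_lower_bound[where T = "t + 1"])
    show "((\<lambda>t. gap s0 v0 t i) has_real_derivative speed v0 \<tau> (i - 1) - speed v0 \<tau> i)
        (at \<tau> within {0..<t + 1})" if "\<tau> \<in> {0..<t + 1}" for \<tau>
      by (rule DERIV_subset[OF gap_has_derivative]) (use that in auto)
    show "\<bar>speed v0 \<tau> j - vstar\<bar> \<le> vmax / 2 * \<Gamma> * exp (- \<mu> * \<tau>)" if "j \<in> {i - 1, i}" for \<tau> j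
      by (rule speed_dist_le, rule err[rule_format]) (use that i in auto)
    show "gap s0 v0 0 i \<ge> lam + vmax / \<mu> * \<Gamma>" using s0 i by (simp add: gap_def)
  qed (use t in auto)
  moreover have "vmax / \<mu> * \<Gamma> * exp (- \<mu> * t) \<ge> 0" using vmax mu \<open>\<Gamma> \<ge> 0\<close> by simp
  ultimately show ?thesis by linarith
qed

lemma explicit_solution: "solution {0..} (gap s0 v0) (speed v0)"
  unfolding is_solution_def
proof (intro ballI conjI)
  fix t :: real assume t: "t \<in> {0..}"
  then have apart: "\<forall>i\<in>{2..n}. gap s0 v0 t i \<ge> lam" using gap_ge by simp
  then show "(gap s0 v0 t, speed v0 t) \<in> state_space n L vmax"
    using lam by (force simp: state_space_iff speed_range)
  show "((\<lambda>t. gap s0 v0 t i) has_real_derivative speed v0 t (i - 1) - speed v0 t i)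
      (at t within {0..})" for i
    using t by (intro gap_has_derivative) simp
  show "((\<lambda>t. speed v0 t i) has_real_derivative F i (gap s0 v0 t) (speed v0 t))
      (at t within {0..})" for i
    by (rule has_field_derivative_at_within[OF speed_has_derivative[OF apart]])
qed

lemma explicit_initial_state: "has_initial_state n s0 v0 (gap s0 v0) (speed v0)"
  using v0 speed_of_err_rel_err[OF vstar]
  by (simp add: has_initial_state_def gap_def speed_def)

text \<open>The solution never interacts, so its weighted errors are those of \<open>speed\<close>; the weighted
  error determines the speed, and the speeds determine the spacings.\<close>

lemma solution_unique:
  assumes sol: "solution {0..<T} s v" and init: "has_initial_state n s0 v0 s v"
    and t: "t \<in> {0..<T}"
  shows "i \<in> {1..n} \<Longrightarrow> v t i = speed v0 t i" "i \<in> {2..n} \<Longrightarrow> s t i = gap s0 v0 t i"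
proof -
  have init: "\<And>i. i \<in> {2..n} \<Longrightarrow> s 0 i = s0 i" "\<And>i. i \<in> {1..n} \<Longrightarrow> v 0 i = v0 i"
    using init by (auto simp: has_initial_state_def)
  have apart: "\<forall>i\<in>{2..n}. s \<tau> i \<ge> lam" if "\<tau> \<in> {0..<T}" for \<tau>
    by (rule stays_apart[OF sol _ _ that, where \<Gamma> = \<Gamma>]) (use err s0 init in auto)
  have v: "v \<tau> i = speed v0 \<tau> i" if \<tau>: "\<tau> \<in> {0..<T}" and i: "i \<in> {1..n}" for \<tau> i
  proof (rule rel_err_inj[OF vstar])
    show "0 < v \<tau> i" "v \<tau> i < vmax"
      using sol \<tau> i by (auto simp: is_solution_def state_space_iff)
    have "rel_err vmax vstar (v \<tau> i) = rel_err vmax vstar (v 0 i) * exp (- \<mu> * \<tau>)"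
      by (rule rel_err_decays[OF sol \<tau> _ i]) (use apart \<tau> in auto)
    then show "rel_err vmax vstar (v \<tau> i) = rel_err vmax vstar (speed v0 \<tau> i)"
      using init(2)[OF i] by (simp add: rel_err_speed)
  qed (auto simp: speed_range)
  show "i \<in> {1..n} \<Longrightarrow> v t i = speed v0 t i" using v t .
  show "s t i = gap s0 v0 t i" if i: "i \<in> {2..n}"
  proof -
    have "s t i - gap s0 v0 t i = s 0 i - gap s0 v0 0 i"
    proof (rule constant_from_start[OF _ t])
      show "((\<lambda>t. s t i - gap s0 v0 t i) has_real_derivative
          (v \<tau> (i - 1) - v \<tau> i) - (speed v0 \<tau> (i - 1) - speed v0 \<tau> i)) (at \<tau> within {0..<T})"
        if "\<tau> \<in> {0..<T}" for \<tau>
        using that sol i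
        by (intro DERIV_diff DERIV_subset[OF gap_has_derivative]) (auto simp: is_solution_def)
      show "(v \<tau> (i - 1) - v \<tau> i) - (speed v0 \<tau> (i - 1) - speed v0 \<tau> i) = 0"
        if "0 < \<tau>" "\<tau> < t" for \<tau>
      proof -
        have "i \<in> {1..n}" "i - 1 \<in> {1..n}" "\<tau> \<in> {0..<T}" using i that t by auto
        then show ?thesis using v by simp
      qed
    qed
    then show ?thesis using init(1)[OF i] by (simp add: gap_def)
  qed
qed

end

end

section \<open>Exponential convergence without collisions\<close>

theorem proposition3:
  fixes n :: nat
    and L lam vmax vstar \<mu> \<Gamma> :: real
    and V b :: "real \<Rightarrow> real"
    and s0 v0 :: "nat \<Rightarrow> real"
  assumes n: "n \<ge> 2"
    and L: "0 < L" and lam: "L < lam"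
    and vmax: "0 < vmax" and vstar: "vstar \<in> {0<..<vmax}"
    and mu: "0 < \<mu>"
    and V_C3: "C_on 3 V {L<..}"
    and V_nonneg: "\<forall>x>L. V x \<ge> 0"
    and V_lim: "filterlim V at_top (at_right L)"
    and V_zero: "\<forall>x\<ge>lam. V x = 0"
    and V_deriv: "\<forall>x\<in>{L<..<lam}. deriv V x < 0 \<and> deriv (deriv V) x > 0"
    and b_C2: "C_on 2 b UNIV"
    and b_range: "\<forall>x. b x \<in> {vstar - vmax<..<vstar}"
    and b_mono: "mono b"
    and b_zero: "b 0 = 0"
    and b_sign: "\<forall>x. x \<noteq> 0 \<longrightarrow> x * b x > 0"
    and b_deriv: "deriv b 0 > 0"
    and init: "(s0, v0) \<in> state_space n L vmax"
    and Gamma: "\<Gamma> = (MAX i\<in>{1..n}.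
          \<bar>v0 i - f_ref n vstar V b i s0\<bar> / sqrt ((vmax - v0 i) * v0 i))"
    and spacing: "(MIN i\<in>{2..n}. s0 i) \<ge> lam + vmax / \<mu> * \<Gamma>"
  shows "\<exists>s v.
    is_solution n L vmax vstar \<mu> V b {0..} s v \<and> has_initial_state n s0 v0 s v \<and>
    (\<forall>T>0. \<forall>s' v'.
       is_solution n L vmax vstar \<mu> V b {0..<T} s' v' \<and> has_initial_state n s0 v0 s' v' \<longrightarrow>
       (\<forall>t\<in>{0..<T}. (\<forall>i\<in>{2..n}. s' t i = s t i) \<and> (\<forall>i\<in>{1..n}. v' t i = v t i))) \<and>
    (\<forall>t\<ge>0.
       (MAX i\<in>{1..n}. \<bar>v t i - vstar\<bar>) \<le> vmax / 2 * \<Gamma> * exp (- \<mu> * t) \<and>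
       (MIN i\<in>{2..n}. s t i) \<ge> lam)"
proof -
  have V_diff: "V differentiable (at x)" "deriv V differentiable (at x)" if "x > L" for x
    using V_C3[unfolded C_on_def, THEN conjunct1, rule_format, of 0 x]
      V_C3[unfolded C_on_def, THEN conjunct1, rule_format, of 1 x] that by simp_all
  have b_diff: "b differentiable (at x)" for x
    using b_C2 unfolding C_on_def by (auto dest: spec[of _ "0::nat"])
  interpret open_road n L lam vmax vstar \<mu> V b
    using n lam vmax vstar mu V_diff V_nonneg V_zero V_deriv b_diff b_range b_zero b_sign
    by unfold_locales auto
  have v0: "0 < v0 i \<and> v0 i < vmax" if "i \<in> {1..n}" for i
    using init that by (auto simp: state_space_iff)
  have ratio_le: "\<bar>v0 i - f i s0\<bar> / sqrt ((vmax - v0 i) * v0 i) \<le> \<Gamma>" if "i \<in> {1..n}" for i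
    unfolding Gamma by (rule Max_ge) (use that in auto)
  have "0 \<le> \<bar>v0 1 - f 1 s0\<bar> / sqrt ((vmax - v0 1) * v0 1)" using v0[of 1] n by simp
  also have "\<dots> \<le> \<Gamma>" using ratio_le[of 1] n by simp
  finally have "\<Gamma> \<ge> 0" .
  have s0: "s0 i \<ge> lam + vmax / \<mu> * \<Gamma>" if "i \<in> {2..n}" for i
    using spacing n that by (auto simp: Min_ge_iff)
  have "lam + vmax / \<mu> * \<Gamma> \<ge> lam" using vmax mu \<open>\<Gamma> \<ge> 0\<close> by simp
  with s0 have "\<forall>i\<in>{2..n}. s0 i \<ge> lam" by force
  then have "f i s0 = vstar" for i by (rule far_apart)
  then have err: "\<bar>rel_err vmax vstar (v0 i)\<bar> \<le> \<Gamma>" if "i \<in> {1..n}" for i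
    using ratio_le[OF that] v0[OF that] by (simp add: rel_err_def abs_mult)
  have facts: "\<forall>i\<in>{1..n}. \<bar>rel_err vmax vstar (v0 i)\<bar> \<le> \<Gamma>"
    "\<forall>i\<in>{2..n}. s0 i \<ge> lam + vmax / \<mu> * \<Gamma>" "\<forall>i\<in>{1..n}. 0 < v0 i \<and> v0 i < vmax"
    using err s0 v0 by auto
  have "(MAX i\<in>{1..n}. \<bar>speed v0 t i - vstar\<bar>) \<le> vmax / 2 * \<Gamma> * exp (- \<mu> * t)" for t
    by (subst Max_le_iff) (use n speed_dist_le[OF err] in auto)
  moreover have "(MIN i\<in>{2..n}. gap s0 v0 t i) \<ge> lam" if "t \<ge> 0" for t
    by (subst Min_ge_iff) (use n gap_ge[OF facts that] in auto)
  ultimately show ?thesis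
    using explicit_solution[OF facts] explicit_initial_state[OF facts] solution_unique[OF facts]
    by (intro exI[of _ "gap s0 v0"] exI[of _ "speed v0"]) blast
qed

end
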